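(* Let $\boldsymbol\pi=(\pi_1,\dots,\pi_{T-1})$ be an online control algorithm of the form $$u_t=\pi_t\big(x_t,\{d_\tau,Q_\tau,R_\tau\}_{\tau=1}^{t},\{d_{i|t},Q_i,R_i\}_{i=t}^{t+W}\big),$$ i.e. whose control action does not rely on the history $\{x_\tau\}_{\tau=1}^{t-1}$. Let $\{x_t^{\boldsymbol\pi}\}$ be the trajectory generated by $\boldsymbol\pi$. Then $$\mathrm{Regret}(\boldsymbol\pi)=\sum_{t=1}^{T-1}(u_t^{\boldsymbol\pi}-u_t^* )^\top(R_t+B_u^\top P_{t+1}B_u)(u_t^{\boldsymbol\pi}-u_t^* ),$$ where $$u_t^{\boldsymbol\pi}=\pi_t\big(x_t^{\boldsymbol\pi},\{d_\tau,Q_\tau,R_\tau\}_{\tau=1}^{t},\{d_{i|t},Q_i,R_i\}_{i=t}^{t+W}\big),\qquad u_t^*=\pi_t^*(x_t^{\boldsymbol\pi},d_t,\dots,d_{T-1}).$$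
   Context: System: $x_{t+1}=Ax_t+B_uu_t+B_dd_t$ for $1\le t\le T-1$, with $x_1\in\mathbb R^n$ fixed, $u_t\in\mathbb R^{n_u}$, $d_t\in\mathbb R^{n_d}$. Cost: $J(\mathbf x,\mathbf u)=\sum_{t=1}^{T-1}(x_t^\top Q_tx_t+u_t^\top R_tu_t)+x_T^\top Q_Tx_T$ with symmetric $Q_t,R_t$. Standing assumptions: $(A,B_u)$ is stabilizable, all $(A,Q_t)$ are detectable, and there are positive definite matrices with $0\prec Q_{\min}\preceq Q_t\preceq Q_{\max}$ for $1\le t\le T$ and $0\prec R_{\min}\preceq R_t\preceq R_{\max}$ for $1\le t\le T-1$. At time $t$ the controller receives predictions $d_{i|t}$ of $d_i$, and the exact $Q_i,R_i$, for $t\le i\le t+W$. $P_T=Q_T$; for $1\le t\le T-1$, $P_t=Q_t+A^\top P_{t+1}A-A^\top P_{t+1}B_u(R_t+B_u^\top P_{t+1}B_u)^{-1}B_u^\top P_{t+1}A$ and $K_t=(R_t+B_u^\top P_{t+1}B_u)^{-1}B_u^\top P_{t+1}A$. $\Phi(t,t_0)=(A-B_uK_{t-1})\cdots(A-B_uK_{t_0})$ for $t>t_0$, $\Phi(t,t)=I$. $K_t^{d,i}=(R_t+B_u^\top P_{t+1}B_u)^{-1}B_u^\top\Phi(i+1,t+1)^\top P_{i+1}$ for $t\le i\le T-1$. The optimal policy (minimizing $J$ when all costs and disturbances are known) is $\pi_t^*(x,d_t,\dots,d_{T-1})=-K_tx-\sum_{i=t}^{T-1}K_t^{d,i}B_dd_i$.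 $\mathrm{Regret}(\boldsymbol\pi)=J(\mathbf x^{\boldsymbol\pi},\mathbf u^{\boldsymbol\pi})-J^*$, where $(\mathbf x^{\boldsymbol\pi},\mathbf u^{\boldsymbol\pi})$ is the state/control trajectory of $\boldsymbol\pi$ started at $x_1$ under the true disturbances and $J^*$ is the minimum of $J$ over all control sequences (in hindsight). *)

theory Defs
  imports "HOL-Analysis.Analysis"
begin

definition pos_semidef :: "real^'n^'n \<Rightarrow> bool" where
  "pos_semidef M \<longleftrightarrow> transpose M = M \<and> (\<forall>x. 0 \<le> x \<bullet> (M *v x))"

definition pos_def :: "real^'n^'n \<Rightarrow> bool" where
  "pos_def M \<longleftrightarrow> transpose M = M \<and> (\<forall>x. x \<noteq> 0 \<longrightarrow> 0 < x \<bullet> (M *v x))"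

definition loewner_le :: "real^'n^'n \<Rightarrow> real^'n^'n \<Rightarrow> bool" where
  "loewner_le M N \<longleftrightarrow> pos_semidef (N - M)"

definition complex_eigenvalue :: "real^'n^'n \<Rightarrow> complex \<Rightarrow> bool" where
  "complex_eigenvalue M z \<longleftrightarrow>
     (\<exists>v :: complex^'n. v \<noteq> 0 \<and> (\<chi> i j. complex_of_real (M $ i $ j)) *v v = z *s v)"

definition schur_stable :: "real^'n^'n \<Rightarrow> bool" where
  "schur_stable M \<longleftrightarrow> (\<forall>z. complex_eigenvalue M z \<longrightarrow> cmod z < 1)"

definition stabilizable :: "real^'n^'n \<Rightarrow> real^'m^'n \<Rightarrow> bool" where
  "stabilizable A B \<longleftrightarrow> (\<exists>K :: real^'n^'m. schur_stable (A - B ** K))"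

definition detectable :: "real^'n^'n \<Rightarrow> real^'n^'p \<Rightarrow> bool" where
  "detectable A C \<longleftrightarrow> (\<exists>L :: real^'p^'n. schur_stable (A - L ** C))"

(* Time indices are naturals starting at 1; states live at times 1..T, while controls and
   disturbances live at times 1..T-1.  Values of the sequences elsewhere are irrelevant
   to the system, the cost and the optimal policy. *)

definition cost ::
  "(nat \<Rightarrow> real^'n^'n) \<Rightarrow> (nat \<Rightarrow> real^'m^'m) \<Rightarrow> nat \<Rightarrow> (nat \<Rightarrow> real^'n) \<Rightarrow> (nat \<Rightarrow> real^'m) \<Rightarrow> real"
  where
  "cost Q R T x u =
     (\<Sum>t\<in>{1..<T}. x t \<bullet> (Q t *v x t) + u t \<bullet> (R t *v u t)) + x T \<bullet> (Q T *v x T)"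

definition is_trajectory ::
  "real^'n^'n \<Rightarrow> real^'m^'n \<Rightarrow> real^'k^'n \<Rightarrow> nat \<Rightarrow> real^'n \<Rightarrow> (nat \<Rightarrow> real^'k)
     \<Rightarrow> (nat \<Rightarrow> real^'n) \<Rightarrow> (nat \<Rightarrow> real^'m) \<Rightarrow> bool"
  where
  "is_trajectory A B\<^sub>u B\<^sub>d T x\<^sub>1 d x u \<longleftrightarrow>
     x 1 = x\<^sub>1 \<and> (\<forall>t\<in>{1..<T}. x (Suc t) = A *v x t + B\<^sub>u *v u t + B\<^sub>d *v d t)"

(* LEAST on the reals denotes an attained minimum, not just the infimum. *)
definition optimal_cost ::
  "real^'n^'n \<Rightarrow> real^'m^'n \<Rightarrow> real^'k^'n \<Rightarrow> (nat \<Rightarrow> real^'n^'n) \<Rightarrow> (nat \<Rightarrow> real^'m^'m)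
     \<Rightarrow> nat \<Rightarrow> real^'n \<Rightarrow> (nat \<Rightarrow> real^'k) \<Rightarrow> real"
  where
  "optimal_cost A B\<^sub>u B\<^sub>d Q R T x\<^sub>1 d =
     (LEAST c. \<exists>x u. is_trajectory A B\<^sub>u B\<^sub>d T x\<^sub>1 d x u \<and> c = cost Q R T x u)"

function riccati ::
  "real^'n^'n \<Rightarrow> real^'m^'n \<Rightarrow> (nat \<Rightarrow> real^'n^'n) \<Rightarrow> (nat \<Rightarrow> real^'m^'m) \<Rightarrow> nat \<Rightarrow> nat \<Rightarrow> real^'n^'n"
  where
  "riccati A B Q R T t =
     (if t < T then
        let P = riccati A B Q R T (Suc t) in
          Q t + transpose A ** P ** A
            - transpose A ** P ** B ** matrix_inv (R t + transpose B ** P ** B)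
                ** transpose B ** P ** A
      else Q T)"
  by pat_completeness auto
termination by (relation "Wellfounded.measure (\<lambda>(A, B, Q, R, T, t). T - t)") auto

declare riccati.simps [simp del]

definition gain ::
  "real^'n^'n \<Rightarrow> real^'m^'n \<Rightarrow> (nat \<Rightarrow> real^'n^'n) \<Rightarrow> (nat \<Rightarrow> real^'m^'m) \<Rightarrow> nat \<Rightarrow> nat \<Rightarrow> real^'n^'m"
  where
  "gain A B Q R T t =
     (let P = riccati A B Q R T (Suc t) in
        matrix_inv (R t + transpose B ** P ** B) ** transpose B ** P ** A)"

(* transition A B Q R T t t0 = (A - B K_(t-1)) ** ... ** (A - B K_(t0)) for t > t0, and the
   identity for t = t0; the argument order is that of the usual notation Phi(t, t0). *)
primrec transition ::
  "real^'n^'n \<Rightarrow> real^'m^'n \<Rightarrow> (nat \<Rightarrow> real^'n^'n) \<Rightarrow> (nat \<Rightarrow> real^'m^'m) \<Rightarrow> nat \<Rightarrow> nat \<Rightarrow> nat \<Rightarrow> real^'n^'n"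
  where
  "transition A B Q R T 0 t\<^sub>0 = mat 1"
| "transition A B Q R T (Suc t) t\<^sub>0 =
     (if t\<^sub>0 \<le> t then (A - B ** gain A B Q R T t) ** transition A B Q R T t t\<^sub>0 else mat 1)"

definition disturbance_gain ::
  "real^'n^'n \<Rightarrow> real^'m^'n \<Rightarrow> (nat \<Rightarrow> real^'n^'n) \<Rightarrow> (nat \<Rightarrow> real^'m^'m) \<Rightarrow> nat \<Rightarrow> nat \<Rightarrow> nat \<Rightarrow> real^'n^'m"
  where
  "disturbance_gain A B Q R T t i =
     matrix_inv (R t + transpose B ** riccati A B Q R T (Suc t) ** B) ** transpose B
       ** transpose (transition A B Q R T (Suc i) (Suc t)) ** riccati A B Q R T (Suc i)"

definition optimal_policy ::
  "real^'n^'n \<Rightarrow> real^'m^'n \<Rightarrow> real^'k^'n \<Rightarrow> (nat \<Rightarrow> real^'n^'n) \<Rightarrow> (nat \<Rightarrow> real^'m^'m)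
     \<Rightarrow> nat \<Rightarrow> nat \<Rightarrow> real^'n \<Rightarrow> (nat \<Rightarrow> real^'k) \<Rightarrow> real^'m"
  where
  "optimal_policy A B\<^sub>u B\<^sub>d Q R T t x d =
     - (gain A B\<^sub>u Q R T t *v x)
     - (\<Sum>i\<in>{t..<T}. disturbance_gain A B\<^sub>u Q R T t i *v (B\<^sub>d *v d i))"

(* An online policy maps the time, the current state, the list of (d, Q, R) for times 1..t and
   the list of (predicted d, Q, R) for times t..t+W to a control.  The type itself
   excludes any dependence on earlier states. *)
type_synonym ('n, 'm, 'k) policy =
  "nat \<Rightarrow> real^'n \<Rightarrow> ((real^'k) \<times> (real^'n^'n) \<times> (real^'m^'m)) list
     \<Rightarrow> ((real^'k) \<times> (real^'n^'n) \<times> (real^'m^'m)) list \<Rightarrow> real^'m"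

(* d_pred t i is the prediction of d i available at time t.  The prediction window is not cut off
   at the horizon; since policies are arbitrary functions, a policy may ignore
   the entries beyond it. *)
definition policy_action ::
  "('n::finite, 'm::finite, 'k::finite) policy \<Rightarrow> (nat \<Rightarrow> real^'n^'n) \<Rightarrow> (nat \<Rightarrow> real^'m^'m)
     \<Rightarrow> nat \<Rightarrow> (nat \<Rightarrow> real^'k) \<Rightarrow> (nat \<Rightarrow> nat \<Rightarrow> real^'k) \<Rightarrow> nat \<Rightarrow> real^'n \<Rightarrow> real^'m"
  where
  "policy_action \<pi> Q R W d d_pred t x =
     \<pi> t x (map (\<lambda>\<tau>. (d \<tau>, Q \<tau>, R \<tau>)) [1..<Suc t])
           (map (\<lambda>i. (d_pred t i, Q i, R i)) [t..<Suc (t + W)])"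

(* The value at time 0 is a dummy. *)
fun policy_state ::
  "real^'n^'n \<Rightarrow> real^'m^'n \<Rightarrow> real^'k^'n \<Rightarrow> (nat \<Rightarrow> real^'n^'n) \<Rightarrow> (nat \<Rightarrow> real^'m^'m)
     \<Rightarrow> nat \<Rightarrow> real^'n \<Rightarrow> (nat \<Rightarrow> real^'k) \<Rightarrow> (nat \<Rightarrow> nat \<Rightarrow> real^'k)
     \<Rightarrow> ('n::finite, 'm::finite, 'k::finite) policy \<Rightarrow> nat \<Rightarrow> real^'n"
  where
  "policy_state A B\<^sub>u B\<^sub>d Q R W x\<^sub>1 d d_pred \<pi> 0 = x\<^sub>1"
| "policy_state A B\<^sub>u B\<^sub>d Q R W x\<^sub>1 d d_pred \<pi> (Suc 0) = x\<^sub>1"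
| "policy_state A B\<^sub>u B\<^sub>d Q R W x\<^sub>1 d d_pred \<pi> (Suc (Suc t)) =
     (let x = policy_state A B\<^sub>u B\<^sub>d Q R W x\<^sub>1 d d_pred \<pi> (Suc t) in
        A *v x + B\<^sub>u *v policy_action \<pi> Q R W d d_pred (Suc t) x + B\<^sub>d *v d (Suc t))"

definition policy_control ::
  "real^'n^'n \<Rightarrow> real^'m^'n \<Rightarrow> real^'k^'n \<Rightarrow> (nat \<Rightarrow> real^'n^'n) \<Rightarrow> (nat \<Rightarrow> real^'m^'m)
     \<Rightarrow> nat \<Rightarrow> real^'n \<Rightarrow> (nat \<Rightarrow> real^'k) \<Rightarrow> (nat \<Rightarrow> nat \<Rightarrow> real^'k)
     \<Rightarrow> ('n::finite, 'm::finite, 'k::finite) policy \<Rightarrow> nat \<Rightarrow> real^'m"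
  where
  "policy_control A B\<^sub>u B\<^sub>d Q R W x\<^sub>1 d d_pred \<pi> t =
     policy_action \<pi> Q R W d d_pred t (policy_state A B\<^sub>u B\<^sub>d Q R W x\<^sub>1 d d_pred \<pi> t)"

definition regret ::
  "real^'n^'n \<Rightarrow> real^'m^'n \<Rightarrow> real^'k^'n \<Rightarrow> (nat \<Rightarrow> real^'n^'n) \<Rightarrow> (nat \<Rightarrow> real^'m^'m)
     \<Rightarrow> nat \<Rightarrow> nat \<Rightarrow> real^'n \<Rightarrow> (nat \<Rightarrow> real^'k) \<Rightarrow> (nat \<Rightarrow> nat \<Rightarrow> real^'k)
     \<Rightarrow> ('n::finite, 'm::finite, 'k::finite) policy \<Rightarrow> real"
  where
  "regret A B\<^sub>u B\<^sub>d Q R T W x\<^sub>1 d d_pred \<pi> =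
     cost Q R T (policy_state A B\<^sub>u B\<^sub>d Q R W x\<^sub>1 d d_pred \<pi>) (policy_control A B\<^sub>u B\<^sub>d Q R W x\<^sub>1 d d_pred \<pi>)
     - optimal_cost A B\<^sub>u B\<^sub>d Q R T x\<^sub>1 d"

end

theory Submission
  imports Defs
begin

text \<open>
  The regret formula is a completion of squares along the trajectory.  Write $w_t = B_d d_t$ and
  $H_t = R_t + B^\top P_{t+1} B$.  The optimal cost-to-go is, up to a constant depending on $t$
  only, the function $V_t(x) = x^\top P_t x + 2 x^\top p_t$, where
  $p_t = \sum_{i=t}^{T-1} \Phi(i+1,t)^\top P_{i+1} w_i$ accounts for the future disturbances.
  Minimising $u \mapsto x^\top Q_t x + u^\top R_t u + V_{t+1}(Ax + Bu + w_t)$, a quadratic with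
  leading matrix $H_t$, gives the minimiser
  $u^* = -K_t x - H_t^{-1} B^\top (P_{t+1} w_t + p_{t+1})$; unrolling $p_{t+1}$ shows that this is
  the optimal policy.  The minimum is $V_t(x)$ plus a constant, and for any other control $u$ the
  excess is exactly $(u - u^*)^\top H_t (u - u^*)$ (\<open>bellman_step\<close>).

  Along any trajectory the differences $V_t(x_t) - V_{t+1}(x_{t+1})$ telescope, so the total cost is
  a constant, the same for all controls, plus the sum of the excesses (\<open>cost_decomposition\<close>).
  Since every $H_t$ is positive definite (\<open>riccati_pos_semidef\<close>), the excesses are nonnegative;
  they all vanish on the closed loop of the optimal policy.  Hence the constant is the minimal cost,
  and the regret is what remains.
\<close>

section \<open>Quadratic forms and definite matrices\<close>

text \<open>
  Transposes are kept on the left of vectors, so that inner products can be moved across them by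
  the adjoint identity below.
\<close>

declare transpose_matrix_vector [simp del]

lemma inner_transpose_mult_right:
  fixes M :: "real^'a^'b"
  shows "x \<bullet> (transpose M *v y) = (M *v x) \<bullet> y"
  by (metis dot_lmul_matrix inner_commute transpose_matrix_vector)

lemma inner_symmetric_mult_commute:
  fixes M :: "real^'a^'a"
  assumes "transpose M = M"
  shows "x \<bullet> (M *v y) = y \<bullet> (M *v x)"
  by (metis assms inner_commute inner_transpose_mult_right)

lemma pos_def_loewner_mono:
  assumes "pos_def M" "loewner_le M N"
  shows "pos_def N"
proof -
  have M: "transpose M = M" "\<And>x. x \<noteq> 0 \<Longrightarrow> 0 < x \<bullet> (M *v x)"
    and NM: "transpose (N - M) = N - M" "\<And>x. 0 \<le> x \<bullet> ((N - M) *v x)"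
    using assms by (auto simp: pos_def_def loewner_le_def pos_semidef_def)
  have "transpose (N - M) = transpose N - transpose M"
    by (simp add: transpose_def vec_eq_iff)
  then have "transpose N = N"
    using M(1) NM(1) by simp
  moreover have "0 < x \<bullet> (N *v x)" if "x \<noteq> 0" for x
    using M(2)[OF that] NM(2)[of x]
    by (simp add: matrix_vector_mult_diff_rdistrib inner_diff_right)
  ultimately show ?thesis
    by (simp add: pos_def_def)
qed

lemma pos_def_imp_pos_semidef: "pos_def M \<Longrightarrow> pos_semidef M"
  unfolding pos_def_def pos_semidef_def by (metis inner_zero_left less_eq_real_def)

lemma pos_def_invertible:
  fixes M :: "real^'a^'a"
  assumes "pos_def M"
  shows "invertible M"
proof -
  have "x = 0" if "M *v x = 0" for x
    using assms that unfolding pos_def_def by (metis inner_zero_right less_irrefl)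
  then show ?thesis
    by (simp add: invertible_left_inverse matrix_left_invertible_ker)
qed

lemma matrix_inv_right:
  fixes M :: "real^'a^'a"
  assumes "invertible M"
  shows "M ** matrix_inv M = mat 1"
  using assms unfolding invertible_def matrix_inv_def by (metis (mono_tags, lifting) someI)

lemma matrix_inv_mult_vec:
  fixes M :: "real^'a^'a"
  assumes "invertible M"
  shows "M *v (matrix_inv M *v x) = x"
  by (simp add: assms matrix_inv_right matrix_vector_mul_assoc)

lemma transpose_matrix_inv:
  fixes M :: "real^'a^'a"
  assumes "invertible M" "transpose M = M"
  shows "transpose (matrix_inv M) = matrix_inv M"
proof -
  have "transpose (matrix_inv M) ** M = mat 1"
    by (metis assms matrix_inv_right matrix_transpose_mul transpose_mat)
  then show ?thesis
    by (metis assms(1) matrix_inv_right matrix_mul_assoc matrix_mul_lid matrix_mul_rid)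
qed

lemma complete_square:
  fixes H :: "real^'a^'a"
  assumes "invertible H" "transpose H = H"
  shows "u \<bullet> (H *v u) + 2 * (u \<bullet> g) =
    (u + matrix_inv H *v g) \<bullet> (H *v (u + matrix_inv H *v g)) - g \<bullet> (matrix_inv H *v g)"
proof -
  have "(matrix_inv H *v g) \<bullet> (H *v u) = u \<bullet> g"
    using inner_symmetric_mult_commute[OF assms(2), of "matrix_inv H *v g" u]
    by (simp add: matrix_inv_mult_vec[OF assms(1)])
  then show ?thesis
    by (simp add: matrix_vector_right_distrib inner_add_left inner_add_right
        matrix_inv_mult_vec[OF assms(1)] inner_commute)
qed

lemma pos_semidef_congruence:
  fixes P :: "real^'a^'a" and B :: "real^'b^'a"
  assumes "pos_semidef P"
  shows "pos_semidef (transpose B ** P ** B)"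
proof -
  have "transpose (transpose B ** P ** B) = transpose B ** P ** B"
    using assms by (simp add: pos_semidef_def matrix_transpose_mul matrix_mul_assoc)
  moreover have "0 \<le> x \<bullet> ((transpose B ** P ** B) *v x)" for x
    using assms
    by (simp add: pos_semidef_def inner_transpose_mult_right flip: matrix_vector_mul_assoc)
  ultimately show ?thesis
    by (simp add: pos_semidef_def)
qed

lemma pos_def_add_pos_semidef:
  assumes "pos_def M" "pos_semidef N"
  shows "pos_def (M + N)"
proof -
  have "transpose (M + N) = transpose M + transpose N"
    by (simp add: transpose_def vec_eq_iff)
  then show ?thesis
    using assms unfolding pos_def_def pos_semidef_def
    by (simp add: matrix_vector_mult_add_rdistrib inner_add_right add_pos_nonneg)
qed

section \<open>One step of dynamic programming\<close>

text \<open>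
  The next cost-to-go is taken as $z^\top P z + 2 p^\top z$; the linear term is what the disturbances
  produce.  With $y = Ax + w$ the expression is a quadratic in $u$ with leading matrix $H$ and
  linear coefficient $g = B^\top(Py + p) = B^\top PAx + B^\top q$, where $q = Pw + p$.  Subtracting
  $g^\top H^{-1} g$ turns $A^\top P A$ into the Riccati update and the linear coefficient
  $A^\top q$ into $(A - BK)^\top q$.
\<close>

lemma bellman_square:
  fixes A P Q :: "real^'n^'n" and B :: "real^'m^'n" and R :: "real^'m^'m"
    and x w p :: "real^'n" and u :: "real^'m"
  assumes P: "transpose P = P" and inv: "invertible (R + transpose B ** P ** B)"
    and sym: "transpose (R + transpose B ** P ** B) = R + transpose B ** P ** B"
  defines "H \<equiv> R + transpose B ** P ** B"
  defines "K \<equiv> matrix_inv H ** transpose B ** P ** A"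
  defines "q \<equiv> P *v w + p"
  defines "v \<equiv> - (K *v x) - matrix_inv H *v (transpose B *v q)"
  defines "z \<equiv> A *v x + B *v u + w"
  shows "x \<bullet> (Q *v x) + u \<bullet> (R *v u) + (z \<bullet> (P *v z) + 2 * (z \<bullet> p)) =
    x \<bullet> ((Q + transpose A ** P ** A
          - transpose A ** P ** B ** matrix_inv H ** transpose B ** P ** A) *v x)
      + 2 * (x \<bullet> (transpose (A - B ** K) *v q))
      + (w \<bullet> (P *v w) + 2 * (w \<bullet> p) - (transpose B *v q) \<bullet> (matrix_inv H *v (transpose B *v q)))
      + (u - v) \<bullet> (H *v (u - v))"
proof -
  define h where "h = transpose B *v (P *v (A *v x))"
  define b where "b = transpose B *v q"
  have symH: "transpose H = H" and invH: "invertible H"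
    using sym inv by (simp_all add: H_def)
  have Kx: "K *v x = matrix_inv H *v h"
    by (simp add: K_def h_def matrix_vector_mul_assoc matrix_mul_assoc)
  have uv: "u - v = u + matrix_inv H *v (h + b)"
    by (simp add: v_def Kx b_def matrix_vector_right_distrib)
  have square: "(u - v) \<bullet> (H *v (u - v)) =
      u \<bullet> (H *v u) + 2 * (u \<bullet> (h + b)) + (h + b) \<bullet> (matrix_inv H *v (h + b))"
    using complete_square[OF invH symH, of u "h + b"] unfolding uv by simp
  have inv_sym: "b \<bullet> (matrix_inv H *v h) = h \<bullet> (matrix_inv H *v b)"
    by (intro inner_symmetric_mult_commute transpose_matrix_inv invH symH)
  have uHu: "u \<bullet> (H *v u) = u \<bullet> (R *v u) + (B *v u) \<bullet> (P *v (B *v u))"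
    by (simp add: H_def matrix_vector_mult_add_rdistrib inner_add_right
        inner_transpose_mult_right flip: matrix_vector_mul_assoc)
  have uh: "u \<bullet> h = (B *v u) \<bullet> (P *v (A *v x))"
    and ub: "u \<bullet> b = (B *v u) \<bullet> (P *v w) + (B *v u) \<bullet> p"
    by (simp_all add: h_def b_def q_def inner_transpose_mult_right inner_add_right)
  have "x \<bullet> ((transpose A ** P ** B ** matrix_inv H ** transpose B ** P ** A) *v x) =
      (P *v (A *v x)) \<bullet> (B *v (matrix_inv H *v h))"
    by (simp add: inner_transpose_mult_right h_def inner_commute
        inner_symmetric_mult_commute[OF P, of "A *v x"] flip: matrix_vector_mul_assoc)
  also have "\<dots> = h \<bullet> (matrix_inv H *v h)"
    by (metis h_def inner_commute inner_transpose_mult_right)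
  finally have quad: "x \<bullet> ((Q + transpose A ** P ** A
          - transpose A ** P ** B ** matrix_inv H ** transpose B ** P ** A) *v x) =
      x \<bullet> (Q *v x) + (A *v x) \<bullet> (P *v (A *v x)) - h \<bullet> (matrix_inv H *v h)"
    by (simp add: matrix_vector_mult_add_rdistrib matrix_vector_mult_diff_rdistrib
        inner_add_right inner_diff_right inner_transpose_mult_right flip: matrix_vector_mul_assoc)
  have "x \<bullet> (transpose (A - B ** K) *v q) = (A *v x) \<bullet> q - (B *v (K *v x)) \<bullet> q"
    by (simp add: inner_transpose_mult_right matrix_vector_mult_diff_rdistrib inner_diff_left
        flip: matrix_vector_mul_assoc)
  also have "(B *v (K *v x)) \<bullet> q = h \<bullet> (matrix_inv H *v b)"
    using inv_sym by (simp add: Kx b_def inner_transpose_mult_right inner_commute)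
  finally have lin: "x \<bullet> (transpose (A - B ** K) *v q) =
      (A *v x) \<bullet> (P *v w) + (A *v x) \<bullet> p - h \<bullet> (matrix_inv H *v b)"
    by (simp add: q_def inner_add_right)
  have zPz: "z \<bullet> (P *v z) + 2 * (z \<bullet> p) =
      (A *v x) \<bullet> (P *v (A *v x)) + (B *v u) \<bullet> (P *v (B *v u)) + w \<bullet> (P *v w)
      + 2 * ((B *v u) \<bullet> (P *v (A *v x))) + 2 * ((B *v u) \<bullet> (P *v w)) + 2 * ((A *v x) \<bullet> (P *v w))
      + 2 * ((A *v x) \<bullet> p) + 2 * ((B *v u) \<bullet> p) + 2 * (w \<bullet> p)"
    using inner_symmetric_mult_commute[OF P, of "A *v x" "B *v u"]
      inner_symmetric_mult_commute[OF P, of w "B *v u"]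
      inner_symmetric_mult_commute[OF P, of w "A *v x"]
    by (simp add: z_def matrix_vector_right_distrib inner_add_left inner_add_right)
  show ?thesis
    unfolding square quad lin zPz b_def[symmetric]
    using uHu uh ub inv_sym
    by (simp add: matrix_vector_right_distrib inner_add_left inner_add_right)
qed

section \<open>The cost-to-go of the disturbed system\<close>

definition control_hessian ::
  "real^'n^'n \<Rightarrow> real^'m^'n \<Rightarrow> (nat \<Rightarrow> real^'n^'n) \<Rightarrow> (nat \<Rightarrow> real^'m^'m) \<Rightarrow> nat \<Rightarrow> nat \<Rightarrow> real^'m^'m"
  where
  "control_hessian A B Q R T t = R t + transpose B ** riccati A B Q R T (Suc t) ** B"

text \<open>The vector $p_t$; half the gradient at the origin of the optimal cost-to-go.\<close>

definition disturbance_costate ::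
  "real^'n^'n \<Rightarrow> real^'m^'n \<Rightarrow> real^'k^'n \<Rightarrow> (nat \<Rightarrow> real^'n^'n) \<Rightarrow> (nat \<Rightarrow> real^'m^'m)
     \<Rightarrow> nat \<Rightarrow> (nat \<Rightarrow> real^'k) \<Rightarrow> nat \<Rightarrow> real^'n"
  where
  "disturbance_costate A B B\<^sub>d Q R T d t =
     (\<Sum>i\<in>{t..<T}. transpose (transition A B Q R T (Suc i) t)
                     *v (riccati A B Q R T (Suc i) *v (B\<^sub>d *v d i)))"

definition value_function ::
  "real^'n^'n \<Rightarrow> real^'m^'n \<Rightarrow> real^'k^'n \<Rightarrow> (nat \<Rightarrow> real^'n^'n) \<Rightarrow> (nat \<Rightarrow> real^'m^'m)
     \<Rightarrow> nat \<Rightarrow> (nat \<Rightarrow> real^'k) \<Rightarrow> nat \<Rightarrow> real^'n \<Rightarrow> real"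
  where
  "value_function A B B\<^sub>d Q R T d t x =
     x \<bullet> (riccati A B Q R T t *v x) + 2 * (x \<bullet> disturbance_costate A B B\<^sub>d Q R T d t)"

lemma value_function_terminal: "value_function A B B\<^sub>d Q R T d T x = x \<bullet> (Q T *v x)"
  by (simp add: value_function_def disturbance_costate_def riccati.simps)

lemma transition_self: "transition A B Q R T t t = mat 1"
  by (cases t) simp_all

lemma transition_peel_first:
  assumes "s < t"
  shows "transition A B Q R T t s = transition A B Q R T t (Suc s) ** (A - B ** gain A B Q R T s)"
  using assms
proof (induction t)
  case 0
  then show ?case by simp
next
  case (Suc t)
  show ?case
  proof (cases "s = t")
    case True
    then show ?thesis
      by (simp add: transition_self)
  next
    case False
    then have "s < t" using Suc.prems by simp
    then show ?thesis
      using Suc.IH by (simp add: matrix_mul_assoc)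
  qed
qed

text \<open>
  The quantity $q_t = P_{t+1} w_t + p_{t+1}$ is the vector through which disturbances enter both
  the next costate and the optimal control.  Its own disturbance $w_t$ joins the sum because
  $\Phi(t+1,t+1) = I$.
\<close>

lemma disturbance_costate_shift:
  assumes "t < T"
  shows "riccati A B Q R T (Suc t) *v (B\<^sub>d *v d t) + disturbance_costate A B B\<^sub>d Q R T d (Suc t) =
    (\<Sum>i\<in>{t..<T}. transpose (transition A B Q R T (Suc i) (Suc t))
                    *v (riccati A B Q R T (Suc i) *v (B\<^sub>d *v d i)))"
  using assms
  by (simp add: disturbance_costate_def sum.atLeast_Suc_lessThan transition_self transpose_mat
      del: transition.simps)

lemma matrix_vector_mult_sum:
  fixes M :: "real^'a^'b"
  shows "M *v (\<Sum>i\<in>S. f i) = (\<Sum>i\<in>S. M *v f i)"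
  by (simp add: linear_sum)

lemma disturbance_costate_step:
  assumes "t < T"
  shows "disturbance_costate A B B\<^sub>d Q R T d t =
    transpose (A - B ** gain A B Q R T t)
      *v (riccati A B Q R T (Suc t) *v (B\<^sub>d *v d t) + disturbance_costate A B B\<^sub>d Q R T d (Suc t))"
  unfolding disturbance_costate_shift[OF assms]
  by (simp add: disturbance_costate_def matrix_vector_mult_sum transition_peel_first
      matrix_transpose_mul matrix_vector_mul_assoc matrix_mul_assoc del: transition.simps)

lemma optimal_policy_eq_costate_feedback:
  assumes "t < T"
  shows "optimal_policy A B B\<^sub>d Q R T t x d =
    - (gain A B Q R T t *v x) - matrix_inv (control_hessian A B Q R T t) *v (transpose B
        *v (riccati A B Q R T (Suc t) *v (B\<^sub>d *v d t) + disturbance_costate A B B\<^sub>d Q R T d (Suc t)))"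
  unfolding disturbance_costate_shift[OF assms]
  by (simp add: optimal_policy_def disturbance_gain_def control_hessian_def matrix_vector_mult_sum
      matrix_vector_mul_assoc matrix_mul_assoc del: transition.simps)

lemma control_hessian_pos_def:
  assumes "pos_def (R t)" "pos_semidef (riccati A B Q R T (Suc t))"
  shows "pos_def (control_hessian A B Q R T t)"
  unfolding control_hessian_def
  by (intro pos_def_add_pos_semidef pos_semidef_congruence assms)

text \<open>
  Subtracting a positive semidefinite matrix in the Riccati update could destroy positivity; it does
  not, because without disturbances $x^\top P_t x$ equals the nonnegative cost
  $x^\top Q_t x + u^\top R_t u + z^\top P_{t+1} z$ of the feedback control $u = -K_t x$, with
  successor state $z$.
\<close>

lemma riccati_pos_semidef:
  fixes A :: "real^'n^'n" and B :: "real^'m^'n"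
  assumes Q: "\<And>t. t \<in> {1..T} \<Longrightarrow> pos_semidef (Q t)"
    and R: "\<And>t. t \<in> {1..<T} \<Longrightarrow> pos_def (R t)"
    and "t \<in> {1..T}"
  shows "pos_semidef (riccati A B Q R T t)"
proof -
  have "t \<le> T" "1 \<le> t" using assms(3) by auto
  then show ?thesis
  proof (induction rule: inc_induct)
    case base
    then show ?case
      using Q[of T] by (simp add: riccati.simps)
  next
    case (step t)
    let ?P = "riccati A B Q R T (Suc t)" and ?H = "control_hessian A B Q R T t"
      and ?K = "gain A B Q R T t"
    have P: "pos_semidef ?P" using step by simp
    have Rt: "pos_def (R t)" and Qt: "pos_semidef (Q t)"
      using step.hyps step.prems by (auto intro: Q R)
    have H: "pos_def ?H" by (intro control_hessian_pos_def Rt P)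
    have symP: "transpose ?P = ?P" and symQ: "transpose (Q t) = Q t" and symH: "transpose ?H = ?H"
      using P Qt H by (simp_all add: pos_semidef_def pos_def_def)
    have invH: "invertible ?H" using H by (rule pos_def_invertible)
    have ric: "riccati A B Q R T t = Q t + transpose A ** ?P ** A
        - transpose A ** ?P ** B ** matrix_inv ?H ** transpose B ** ?P ** A"
      using step.hyps by (subst riccati.simps) (simp add: control_hessian_def Let_def)
    have transpose_add: "transpose (X + Y) = transpose X + transpose Y"
      and transpose_diff: "transpose (X - Y) = transpose X - transpose Y" for X Y :: "real^'n^'n"
      by (simp_all add: transpose_def vec_eq_iff)
    have "transpose (riccati A B Q R T t) = riccati A B Q R T t"
      unfolding ric
      by (simp add: transpose_add transpose_diff matrix_transpose_mul matrix_mul_assoc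
          symP symQ transpose_matrix_inv[OF invH symH])
    moreover have "0 \<le> x \<bullet> (riccati A B Q R T t *v x)" for x
    proof -
      define u where "u = - (?K *v x)"
      define z where "z = A *v x + B *v u"
      have "x \<bullet> (Q t *v x) + u \<bullet> (R t *v u) + z \<bullet> (?P *v z) = x \<bullet> (riccati A B Q R T t *v x)"
        using bellman_square[OF symP, of "R t" B x "Q t" u A 0 0] invH symH
        by (simp add: ric control_hessian_def gain_def Let_def u_def z_def)
      moreover have "0 \<le> x \<bullet> (Q t *v x)" "0 \<le> u \<bullet> (R t *v u)" "0 \<le> z \<bullet> (?P *v z)"
        using Qt pos_def_imp_pos_semidef[OF Rt] P by (simp_all add: pos_semidef_def)
      ultimately show ?thesis by linarith
    qed
    ultimately show ?case
      by (simp add: pos_semidef_def)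
  qed
qed

lemma bellman_step:
  fixes A :: "real^'n^'n" and B :: "real^'m^'n" and B\<^sub>d :: "real^'k^'n"
  assumes "t < T" and P: "pos_semidef (riccati A B Q R T (Suc t))" and R: "pos_def (R t)"
  obtains c where "\<And>x u. x \<bullet> (Q t *v x) + u \<bullet> (R t *v u)
      + value_function A B B\<^sub>d Q R T d (Suc t) (A *v x + B *v u + B\<^sub>d *v d t) =
    value_function A B B\<^sub>d Q R T d t x + c
      + (u - optimal_policy A B B\<^sub>d Q R T t x d)
          \<bullet> (control_hessian A B Q R T t *v (u - optimal_policy A B B\<^sub>d Q R T t x d))"
proof -
  let ?P = "riccati A B Q R T (Suc t)" and ?H = "control_hessian A B Q R T t"
    and ?p = "disturbance_costate A B B\<^sub>d Q R T d (Suc t)" and ?w = "B\<^sub>d *v d t"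
  have H: "pos_def ?H" by (intro control_hessian_pos_def R P)
  have symP: "transpose ?P = ?P" and symH: "transpose ?H = ?H"
    using P H by (simp_all add: pos_semidef_def pos_def_def)
  have invH: "invertible ?H" using H by (rule pos_def_invertible)
  have ric: "riccati A B Q R T t = Q t + transpose A ** ?P ** A
      - transpose A ** ?P ** B ** matrix_inv ?H ** transpose B ** ?P ** A"
    using assms(1) by (subst riccati.simps) (simp add: control_hessian_def Let_def)
  have K: "gain A B Q R T t = matrix_inv ?H ** transpose B ** ?P ** A"
    by (simp add: gain_def control_hessian_def Let_def)
  show ?thesis
    by (rule that, unfold value_function_def ric disturbance_costate_step[OF assms(1)]
        optimal_policy_eq_costate_feedback[OF assms(1)] K control_hessian_def)
      (rule bellman_square[OF symP invH[unfolded control_hessian_def]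
          symH[unfolded control_hessian_def]])
qed

section \<open>Decomposition of the cost along a trajectory\<close>

definition control_gap ::
  "real^'n^'n \<Rightarrow> real^'m^'n \<Rightarrow> real^'k^'n \<Rightarrow> (nat \<Rightarrow> real^'n^'n) \<Rightarrow> (nat \<Rightarrow> real^'m^'m)
     \<Rightarrow> nat \<Rightarrow> (nat \<Rightarrow> real^'k) \<Rightarrow> nat \<Rightarrow> real^'n \<Rightarrow> real^'m \<Rightarrow> real"
  where
  "control_gap A B B\<^sub>d Q R T d t x u =
     (u - optimal_policy A B B\<^sub>d Q R T t x d)
       \<bullet> (control_hessian A B Q R T t *v (u - optimal_policy A B B\<^sub>d Q R T t x d))"

text \<open>
  The constant \<open>c\<close> is chosen before the trajectory: it collects $V_1(x_1)$ and the
  disturbance-only terms of the single steps.  This uniformity is what later identifies it with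
  the minimal cost.
\<close>

lemma cost_decomposition:
  fixes A :: "real^'n^'n" and B :: "real^'m^'n" and B\<^sub>d :: "real^'k^'n"
  assumes "1 \<le> T"
    and P: "\<And>t. t \<in> {1..T} \<Longrightarrow> pos_semidef (riccati A B Q R T t)"
    and R: "\<And>t. t \<in> {1..<T} \<Longrightarrow> pos_def (R t)"
  obtains c where "\<And>x u. is_trajectory A B B\<^sub>d T x\<^sub>1 d x u \<Longrightarrow>
    cost Q R T x u = c + (\<Sum>t\<in>{1..<T}. control_gap A B B\<^sub>d Q R T d t (x t) (u t))"
proof -
  let ?V = "value_function A B B\<^sub>d Q R T d" and ?gap = "control_gap A B B\<^sub>d Q R T d"
  have "\<exists>c. \<forall>x u. x \<bullet> (Q t *v x) + u \<bullet> (R t *v u) + ?V (Suc t) (A *v x + B *v u + B\<^sub>d *v d t) =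
      ?V t x + c + ?gap t x u" if t: "t \<in> {1..<T}" for t
  proof -
    have "t < T" "pos_semidef (riccati A B Q R T (Suc t))" "pos_def (R t)"
      using t by (auto intro: P R)
    then show ?thesis
      unfolding control_gap_def using bellman_step by metis
  qed
  then obtain c where c: "\<And>t x u. t \<in> {1..<T} \<Longrightarrow>
      x \<bullet> (Q t *v x) + u \<bullet> (R t *v u) + ?V (Suc t) (A *v x + B *v u + B\<^sub>d *v d t) =
      ?V t x + c t + ?gap t x u"
    by metis
  show ?thesis
  proof (rule that)
    fix x u
    assume traj: "is_trajectory A B B\<^sub>d T x\<^sub>1 d x u"
    have stage: "x t \<bullet> (Q t *v x t) + u t \<bullet> (R t *v u t) =
        c t + ?gap t (x t) (u t) - (?V (Suc t) (x (Suc t)) - ?V t (x t))" if "t \<in> {1..<T}" for t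
      using c[OF that, of "x t" "u t"] traj that by (simp add: is_trajectory_def)
    have "cost Q R T x u =
        (\<Sum>t\<in>{1..<T}. c t + ?gap t (x t) (u t) - (?V (Suc t) (x (Suc t)) - ?V t (x t))) + ?V T (x T)"
      by (simp add: cost_def stage value_function_terminal)
    also have "\<dots> = (\<Sum>t\<in>{1..<T}. c t) + (\<Sum>t\<in>{1..<T}. ?gap t (x t) (u t))
        - (?V T (x T) - ?V 1 (x 1)) + ?V T (x T)"
      using sum_Suc_diff'[OF assms(1), of "\<lambda>t. ?V t (x t)"]
      by (simp add: sum_subtractf sum.distrib)
    also have "\<dots> = (?V 1 x\<^sub>1 + (\<Sum>t\<in>{1..<T}. c t)) + (\<Sum>t\<in>{1..<T}. ?gap t (x t) (u t))"
      using traj by (simp add: is_trajectory_def)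
    finally show "cost Q R T x u =
      (?V 1 x\<^sub>1 + (\<Sum>t\<in>{1..<T}. c t)) + (\<Sum>t\<in>{1..<T}. ?gap t (x t) (u t))" .
  qed
qed

lemma policy_is_trajectory:
  "is_trajectory A B B\<^sub>d T x\<^sub>1 d
     (policy_state A B B\<^sub>d Q R W x\<^sub>1 d d_pred \<pi>) (policy_control A B B\<^sub>d Q R W x\<^sub>1 d d_pred \<pi>)"
  unfolding is_trajectory_def
proof (intro conjI ballI)
  fix t assume "t \<in> {1..<T}"
  then obtain s where "t = Suc s" by (cases t) auto
  then show "policy_state A B B\<^sub>d Q R W x\<^sub>1 d d_pred \<pi> (Suc t) =
      A *v policy_state A B B\<^sub>d Q R W x\<^sub>1 d d_pred \<pi> t
      + B *v policy_control A B B\<^sub>d Q R W x\<^sub>1 d d_pred \<pi> t + B\<^sub>d *v d t"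
    by (simp add: policy_control_def Let_def)
qed simp

section \<open>The regret\<close>

theorem lemma1:
  fixes A :: "real^'n^'n" and B\<^sub>u :: "real^'m^'n" and B\<^sub>d :: "real^'k^'n"
    and Q :: "nat \<Rightarrow> real^'n^'n" and R :: "nat \<Rightarrow> real^'m^'m"
    and Q_min Q_max :: "real^'n^'n" and R_min R_max :: "real^'m^'m"
    and T W :: nat and x\<^sub>1 :: "real^'n"
    and d :: "nat \<Rightarrow> real^'k" and d_pred :: "nat \<Rightarrow> nat \<Rightarrow> real^'k"
    and \<pi> :: "('n, 'm, 'k) policy"
  assumes "1 \<le> T"
    and "stabilizable A B\<^sub>u"
    and "\<And>t. t \<in> {1..T} \<Longrightarrow> detectable A (Q t)"
    and "\<And>t. t \<in> {1..T} \<Longrightarrow> transpose (Q t) = Q t"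
    and "\<And>t. t \<in> {1..<T} \<Longrightarrow> transpose (R t) = R t"
    and "pos_def Q_min" and "pos_def Q_max" and "pos_def R_min" and "pos_def R_max"
    and "\<And>t. t \<in> {1..T} \<Longrightarrow> loewner_le Q_min (Q t) \<and> loewner_le (Q t) Q_max"
    and "\<And>t. t \<in> {1..<T} \<Longrightarrow> loewner_le R_min (R t) \<and> loewner_le (R t) R_max"
  shows "regret A B\<^sub>u B\<^sub>d Q R T W x\<^sub>1 d d_pred \<pi> =
    (\<Sum>t\<in>{1..<T}.
       let u = policy_control A B\<^sub>u B\<^sub>d Q R W x\<^sub>1 d d_pred \<pi> t;
           u_opt = optimal_policy A B\<^sub>u B\<^sub>d Q R T t (policy_state A B\<^sub>u B\<^sub>d Q R W x\<^sub>1 d d_pred \<pi> t) d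
       in (u - u_opt) \<bullet>
            ((R t + transpose B\<^sub>u ** riccati A B\<^sub>u Q R T (Suc t) ** B\<^sub>u) *v (u - u_opt)))"
proof -
  let ?gap = "control_gap A B\<^sub>u B\<^sub>d Q R T d"
  have Qpd: "pos_def (Q t)" if "t \<in> {1..T}" for t
    using pos_def_loewner_mono assms(6,10) that by blast
  have Rpd: "pos_def (R t)" if "t \<in> {1..<T}" for t
    using pos_def_loewner_mono assms(8,11) that by blast
  have P: "pos_semidef (riccati A B\<^sub>u Q R T t)" if "t \<in> {1..T}" for t
    using that by (intro riccati_pos_semidef pos_def_imp_pos_semidef Qpd Rpd)
  obtain c where c: "\<And>x u. is_trajectory A B\<^sub>u B\<^sub>d T x\<^sub>1 d x u \<Longrightarrow>
      cost Q R T x u = c + (\<Sum>t\<in>{1..<T}. ?gap t (x t) (u t))"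
    using cost_decomposition[OF assms(1) P Rpd] by blast
  have gap_nonneg: "0 \<le> ?gap t x u" if "t \<in> {1..<T}" for t x u
  proof -
    have "pos_def (control_hessian A B\<^sub>u Q R T t)"
      using that by (intro control_hessian_pos_def Rpd P) auto
    then show ?thesis
      using pos_def_imp_pos_semidef by (auto simp: control_gap_def pos_semidef_def)
  qed
  have "optimal_cost A B\<^sub>u B\<^sub>d Q R T x\<^sub>1 d = c"
    unfolding optimal_cost_def
  proof (rule Least_equality)
    \<comment> \<open>A policy is an arbitrary function, so it may have the true disturbances \<open>d\<close> built in and
      ignore its two information lists.  The closed loop of the optimal policy is then a special
      case of the general closed loop.\<close>
    define opt :: "('n, 'm, 'k) policy"
      where "opt = (\<lambda>t x _ _. optimal_policy A B\<^sub>u B\<^sub>d Q R T t x d)"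
    let ?x = "policy_state A B\<^sub>u B\<^sub>d Q R W x\<^sub>1 d d_pred opt"
      and ?u = "policy_control A B\<^sub>u B\<^sub>d Q R W x\<^sub>1 d d_pred opt"
    have "?u t = optimal_policy A B\<^sub>u B\<^sub>d Q R T t (?x t) d" for t
      by (simp add: policy_control_def policy_action_def opt_def)
    then have "?gap t (?x t) (?u t) = 0" for t
      by (simp add: control_gap_def)
    then have "cost Q R T ?x ?u = c"
      using c[OF policy_is_trajectory] by simp
    then show "\<exists>x u. is_trajectory A B\<^sub>u B\<^sub>d T x\<^sub>1 d x u \<and> c = cost Q R T x u"
      using policy_is_trajectory by metis
  next
    fix y
    assume "\<exists>x u. is_trajectory A B\<^sub>u B\<^sub>d T x\<^sub>1 d x u \<and> y = cost Q R T x u"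
    then show "c \<le> y"
      using c by (auto intro!: sum_nonneg gap_nonneg)
  qed
  then show ?thesis
    by (simp add: regret_def c[OF policy_is_trajectory] control_gap_def control_hessian_def Let_def)
qed

end
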